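(* For every constant $s \geq 3$, the one-round bandwidth complexity of $\textsc{Detect}(K_s)$ under both node insertions and edge insertions is $\Omega(\log \log \log n)$. This lower bound holds even when restricted to bounded-degree dynamic networks (maximum degree $O(1)$).
   Context: Dynamic network model: a dynamic network is a sequence of graphs $G^0, G^1, \ldots$ with $n$ nodes in total, where each $G^i$ ($i \ge 1$) is either identical to $G^{i-1}$ or obtained from it by a single topological change; here both edge insertions and node insertions are allowed (a node insertion adds a new node adjacent to an arbitrary subset of existing nodes). Nodes have distinct identifiers from $[n]$, each node knows the identifiers of its current neighbors, and every node initially knows the entire topology of $G^0$. Communication is synchronous: in each round the topological change (if any) happens first, then each node may send a $B$-bit message to each of its current neighbors; $B$ is the bandwidth. A node learns of changes only by comparing its neighbor list between consecutive rounds (so a node seeing one new neighbor cannot tell whether an edge or a node was inserted). Algorithms are deterministic. A one-round algorithm must, after each round's topological change and that round's communication, output correctly for the current graph. The one-round bandwidth complexity is the minimum $B$ (as a function of $n$) for which such an algorithm exists. $\textsc{Detect}(H)$: if the current graph contains no subgraph isomorphic to $H$, all nodes must output No; otherwise at least one node must output Yes. $K_s$ is the clique on $s$ nodes. *)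

theory Defs
  imports Complex_Main "HOL-Library.Landau_Symbols"
begin

text \<open>A graph is a pair of a vertex set and a set of two-element edges. Vertices are node
  identifiers. The graph without vertices is allowed.\<close>

type_synonym graph = "nat set \<times> nat set set"

abbreviation verts :: "graph \<Rightarrow> nat set" where "verts \<equiv> fst"
abbreviation edges :: "graph \<Rightarrow> nat set set" where "edges \<equiv> snd"

definition simple_graph :: "graph \<Rightarrow> bool" where
  "simple_graph G \<longleftrightarrow> finite (verts G) \<and>
     edges G \<subseteq> {{u, v} | u v. u \<in> verts G \<and> v \<in> verts G \<and> u \<noteq> v}"

definition neighbors :: "graph \<Rightarrow> nat \<Rightarrow> nat set" where
  "neighbors G v = {u. {u, v} \<in> edges G}"

definition contains_copy :: "graph \<Rightarrow> graph \<Rightarrow> bool" where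
  "contains_copy H G \<longleftrightarrow>
     (\<exists>f. inj_on f (verts H) \<and> f ` verts H \<subseteq> verts G \<and> (\<forall>e\<in>edges H. f ` e \<in> edges G))"

definition clique :: "nat \<Rightarrow> graph" where
  "clique s = ({1..s}, {{i, j} | i j. i \<in> {1..s} \<and> j \<in> {1..s} \<and> i \<noteq> j})"

definition edge_insertion :: "graph \<Rightarrow> graph \<Rightarrow> bool" where
  "edge_insertion G G' \<longleftrightarrow>
     (\<exists>u v. u \<in> verts G \<and> v \<in> verts G \<and> u \<noteq> v \<and> {u, v} \<notin> edges G \<and>
        G' = (verts G, insert {u, v} (edges G)))"

definition node_insertion :: "graph \<Rightarrow> graph \<Rightarrow> bool" where
  "node_insertion G G' \<longleftrightarrow>
     (\<exists>v S. v \<notin> verts G \<and> S \<subseteq> verts G \<and>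
        G' = (insert v (verts G), edges G \<union> {{v, u} | u. u \<in> S}))"

text \<open>The requirement on the union says that \<open>n\<close> nodes occur in total, with identifiers
  \<open>1, \<dots>, n\<close>; a node that is not yet inserted is not a vertex.\<close>

definition dynamic_networks :: "nat \<Rightarrow> (nat \<Rightarrow> graph) set" where
  "dynamic_networks n = {G. (\<forall>i. simple_graph (G i)) \<and> (\<Union>i. verts (G i)) = {1..n} \<and>
     (\<forall>i. G (Suc i) = G i \<or> edge_insertion (G i) (G (Suc i)) \<or> node_insertion (G i) (G (Suc i)))}"

definition bounded_degree_networks :: "nat \<Rightarrow> nat \<Rightarrow> (nat \<Rightarrow> graph) set" where
  "bounded_degree_networks \<Delta> n =
     {G \<in> dynamic_networks n. \<forall>i. \<forall>v\<in>verts (G i). card (neighbors (G i) v) \<le> \<Delta>}"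

text \<open>A node may stay silent towards a neighbor, which is \<open>None\<close>.

  Local computation is unrestricted, so the state of a node is taken to be everything it has seen:
  one entry per past round, holding its neighbor set in that round and the messages received, or
  \<open>None\<close> for a round in which the node was not in the network. The length of the
  history is thus the number of rounds elapsed, a clock shared by all nodes.\<close>

type_synonym message = "bool list option"
type_synonym history = "(nat set \<times> (nat \<Rightarrow> message)) option list"

text \<open>\<open>send A G\<^sub>0 v h N u\<close> is the message from \<open>v\<close> to its neighbor \<open>u\<close>, and
  \<open>says_yes A G\<^sub>0 v h\<close> is the output of \<open>v\<close>, where \<open>G\<^sub>0\<close> is the
  initial graph, \<open>h\<close> the history of \<open>v\<close> up to the last completed round, and
  \<open>N\<close> its neighbor set in the current round (after the topological change).\<close>

record algorithm =
  send :: "graph \<Rightarrow> nat \<Rightarrow> history \<Rightarrow> nat set \<Rightarrow> nat \<Rightarrow> message"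
  says_yes :: "graph \<Rightarrow> nat \<Rightarrow> history \<Rightarrow> bool"

definition has_bandwidth :: "algorithm \<Rightarrow> nat \<Rightarrow> bool" where
  "has_bandwidth A B \<longleftrightarrow>
     (\<forall>G\<^sub>0 v h N u m. send A G\<^sub>0 v h N u = Some m \<longrightarrow> length m = B)"

text \<open>\<open>history_of A G t v\<close> is the history of \<open>v\<close> after rounds \<open>1, \<dots>, t\<close>.\<close>

primrec history_of :: "algorithm \<Rightarrow> (nat \<Rightarrow> graph) \<Rightarrow> nat \<Rightarrow> nat \<Rightarrow> history" where
  "history_of A G 0 = (\<lambda>v. [])"
| "history_of A G (Suc t) = (\<lambda>v. history_of A G t v @
     [if v \<in> verts (G (Suc t))
      then Some (neighbors (G (Suc t)) v,
                 \<lambda>u. if u \<in> neighbors (G (Suc t)) v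
                     then send A (G 0) u (history_of A G t u) (neighbors (G (Suc t)) u) v
                     else None)
      else None])"

definition detects :: "algorithm \<Rightarrow> graph \<Rightarrow> (nat \<Rightarrow> graph) \<Rightarrow> bool" where
  "detects A H G \<longleftrightarrow>
     (\<forall>t\<ge>1. if contains_copy H (G t)
            then \<exists>v\<in>verts (G t). says_yes A (G 0) v (history_of A G t v)
            else \<forall>v\<in>verts (G t). \<not> says_yes A (G 0) v (history_of A G t v))"

text \<open>The minimum is over a nonempty set for cliques, see \<open>clique_algorithm_exists\<close> below.\<close>

definition one_round_bandwidth_complexity ::
    "(nat \<Rightarrow> (nat \<Rightarrow> graph) set) \<Rightarrow> graph \<Rightarrow> nat \<Rightarrow> nat" where
  "one_round_bandwidth_complexity \<N> H n =
     (LEAST B. \<exists>A. has_bandwidth A B \<and> (\<forall>G\<in>\<N> n. detects A H G))"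

text \<open>With bandwidth \<open>n\<close>, every node sends its neighbor set, so that it knows all edges among its neighbors.\<close>

definition encode :: "nat \<Rightarrow> nat set \<Rightarrow> bool list" where
  "encode n N = map (\<lambda>i. Suc i \<in> N) [0..<n]"

definition decode :: "nat \<Rightarrow> bool list \<Rightarrow> nat set" where
  "decode n m = {Suc i | i. i < n \<and> m ! i}"

lemma decode_encode: "N \<subseteq> {1..n} \<Longrightarrow> decode n (encode n N) = N"
proof (intro set_eqI iffI)
  fix x assume "N \<subseteq> {1..n}" "x \<in> N"
  then have "x = Suc (x - 1)" "x - 1 < n" by (auto simp: subset_iff Suc_le_eq less_imp_diff_less)
  then show "x \<in> decode n (encode n N)"
    using \<open>x \<in> N\<close> unfolding decode_def encode_def by force
qed (auto simp: decode_def encode_def)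

definition local_graph :: "nat \<Rightarrow> nat \<Rightarrow> nat set \<times> (nat \<Rightarrow> message) \<Rightarrow> graph" where
  "local_graph n v = (\<lambda>(N, rcv). (insert v N,
     {{u, v} | u. u \<in> N} \<union> {{w, u} | u w. u \<in> N \<and> w \<in> decode n (the (rcv u))}))"

lemma local_graph_eq:
  assumes "\<And>u. u \<in> N \<Longrightarrow> decode n (the (rcv u)) = M u"
  shows "local_graph n v (N, rcv) =
    (insert v N, {{u, v} | u. u \<in> N} \<union> {{w, u} | u w. u \<in> N \<and> w \<in> M u})"
proof -
  have "{{w, u} | u w. u \<in> N \<and> w \<in> decode n (the (rcv u))} = {{w, u} | u w. u \<in> N \<and> w \<in> M u}"
    using assms by blast
  then show ?thesis by (simp add: local_graph_def)
qed

definition full_algorithm :: "nat \<Rightarrow> graph \<Rightarrow> algorithm" where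
  "full_algorithm n H =
     \<lparr>send = (\<lambda>_ _ _ N _. Some (encode n N)),
      says_yes = (\<lambda>_ v h. h \<noteq> [] \<and> last h \<noteq> None \<and>
                          contains_copy H (local_graph n v (the (last h))))\<rparr>"

lemma neighbors_subset:
  assumes "simple_graph G"
  shows "neighbors G v \<subseteq> verts G"
  using assms unfolding simple_graph_def neighbors_def by (fastforce simp: doubleton_eq_iff)

lemma verts_clique: "verts (clique s) = {1..s}"
  by (simp add: clique_def)

lemma contains_copy_mono:
  assumes "contains_copy H G" "verts G \<subseteq> verts G'" "edges G \<subseteq> edges G'"
  shows "contains_copy H G'"
proof -
  obtain f where "inj_on f (verts H)" "f ` verts H \<subseteq> verts G" "\<forall>e\<in>edges H. f ` e \<in> edges G"
    using assms(1) unfolding contains_copy_def by (elim exE conjE)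
  then show ?thesis
    unfolding contains_copy_def using assms(2,3) by (intro exI[of _ f]) (simp add: subset_iff)
qed

lemma full_algorithm_detects:
  assumes s: "1 \<le> s" and G: "G \<in> dynamic_networks n"
  shows "detects (full_algorithm n (clique s)) (clique s) G"
  unfolding detects_def
proof (intro allI impI)
  let ?A = "full_algorithm n (clique s)"
  fix t :: nat assume "1 \<le> t"
  then obtain t' where t: "t = Suc t'" by (cases t) auto
  have simple: "simple_graph (G t)" and V: "verts (G t) \<subseteq> {1..n}"
    using G by (auto simp: dynamic_networks_def)
  have dec: "decode n (encode n (neighbors (G t) u)) = neighbors (G t) u" for u
    using decode_encode neighbors_subset[OF simple] V by (meson order_trans)
  define L where "L v = (insert v (neighbors (G t) v),
     {{u, v} | u. u \<in> neighbors (G t) v} \<union>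
     {{w, u} | u w. u \<in> neighbors (G t) v \<and> w \<in> neighbors (G t) u})" for v
  have yes: "says_yes ?A (G 0) v (history_of ?A G t v) = contains_copy (clique s) (L v)"
    if "v \<in> verts (G t)" for v
  proof -
    have "local_graph n v (the (last (history_of ?A G t v))) = L v"
      using that dec by (simp add: t full_algorithm_def L_def local_graph_eq)
    then show ?thesis
      using that by (simp add: full_algorithm_def t)
  qed
  have sub: "verts (L v) \<subseteq> verts (G t)" "edges (L v) \<subseteq> edges (G t)" if "v \<in> verts (G t)" for v
    using that neighbors_subset[OF simple] by (auto simp: L_def neighbors_def)
  have complete: "contains_copy (clique s) (L (f 1))" "f 1 \<in> verts (G t)"
    if inj: "inj_on f {1..s}" and im: "f ` {1..s} \<subseteq> verts (G t)"
      and e: "\<forall>e\<in>edges (clique s). f ` e \<in> edges (G t)" for f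
  proof -
    have adj: "{f i, f j} \<in> edges (G t)" if "i \<in> {1..s}" "j \<in> {1..s}" "i \<noteq> j" for i j
    proof -
      have "{i, j} \<in> edges (clique s)" using that by (auto simp: clique_def)
      then have "f ` {i, j} \<in> edges (G t)" using e by blast
      then show ?thesis by simp
    qed
    have nb: "f i \<in> neighbors (G t) (f 1)" if "i \<in> {1..s}" "i \<noteq> 1" for i
      using adj[of i 1] that s by (simp add: neighbors_def)
    have "f ` {1..s} \<subseteq> verts (L (f 1))"
    proof (intro image_subsetI)
      fix i assume "i \<in> {1..s}"
      then show "f i \<in> verts (L (f 1))" using nb[of i] by (cases "i = 1") (simp_all add: L_def)
    qed
    moreover have "f ` e \<in> edges (L (f 1))" if "e \<in> edges (clique s)" for e
    proof -
      obtain i j where ij: "e = {i, j}" "i \<in> {1..s}" "j \<in> {1..s}" "i \<noteq> j"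
        using \<open>e \<in> edges (clique s)\<close> by (auto simp: clique_def)
      have fe: "f ` e = {f i, f j}" "f ` e = {f j, f i}" using ij by auto
      show ?thesis
      proof (cases "j = 1")
        case True
        then show ?thesis using nb[of i] ij fe by (auto simp: L_def)
      next
        case False
        have "f i \<in> neighbors (G t) (f j)" using adj ij by (simp add: neighbors_def)
        then show ?thesis using nb[of j] False ij fe(1) by (auto simp: L_def)
      qed
    qed
    ultimately show "contains_copy (clique s) (L (f 1))"
      using inj unfolding contains_copy_def verts_clique by blast
    show "f 1 \<in> verts (G t)" using im s by auto
  qed
  show "if contains_copy (clique s) (G t)
        then \<exists>v\<in>verts (G t). says_yes ?A (G 0) v (history_of ?A G t v)
        else \<forall>v\<in>verts (G t). \<not> says_yes ?A (G 0) v (history_of ?A G t v)"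
  proof (cases "contains_copy (clique s) (G t)")
    case True
    then obtain f where f: "inj_on f {1..s}" "f ` {1..s} \<subseteq> verts (G t)"
      "\<forall>e\<in>edges (clique s). f ` e \<in> edges (G t)"
      unfolding contains_copy_def verts_clique by blast
    have "says_yes ?A (G 0) (f 1) (history_of ?A G t (f 1))"
      unfolding yes[OF complete(2)[OF f]] by (rule complete(1)[OF f])
    then show ?thesis
      unfolding if_P[OF True] by (rule bexI) (rule complete(2)[OF f])
  next
    case False
    have "\<not> contains_copy (clique s) (L v)" if "v \<in> verts (G t)" for v
      using False contains_copy_mono[OF _ sub[OF that]] by blast
    then show ?thesis
      unfolding if_not_P[OF False] by (simp add: yes)
  qed
qed

lemma clique_algorithm_exists:
  assumes "1 \<le> s" and "\<N> n \<subseteq> dynamic_networks n"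
  shows "\<exists>B A. has_bandwidth A B \<and> (\<forall>G\<in>\<N> n. detects A (clique s) G)"
proof (intro exI conjI)
  show "has_bandwidth (full_algorithm n (clique s)) n"
    by (auto simp: has_bandwidth_def full_algorithm_def encode_def)
  show "\<forall>G\<in>\<N> n. detects (full_algorithm n (clique s)) (clique s) G"
    using full_algorithm_detects assms by blast
qed

end

theory Submission
  imports Defs "HOL-Library.FuncSet"
begin

text \<open>Let \<open>r = s - 2\<close>. Start from the empty graph, insert a large pool of isolated nodes, and then several
  blocks of \<open>r\<close> nodes, each block becoming a clique attached to at most two pool nodes. A block
  attached to \<open>a\<close> and \<open>d\<close> becomes a \<open>K\<^sub>s\<close> when the edge \<open>{a, d}\<close> is inserted, and then
  some node has to answer Yes. A node other than \<open>a\<close> and \<open>d\<close>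
  confuses this with the insertion of a new node \<open>x\<close> adjacent to \<open>a\<close> and \<open>d\<close>, and
  \<open>a\<close> and \<open>d\<close> confuse it with the insertion of \<open>{a, d}\<close> when \<open>a\<close> and
  \<open>d\<close> are attached to different blocks.

  Colour a pair \<open>u < v\<close> of pool nodes by everything exchanged between them and a block attached to
  both. By Ramsey's theorem there are \<open>a < b < c < d\<close> all of whose pairs have the same colour:
  a block then gets the same messages whether the last neighbor of \<open>a\<close> is \<open>d\<close> or
  \<open>x \<in> {b, c}\<close>, and \<open>a\<close> the same messages whether its block is shared with \<open>b\<close> or with
  \<open>d\<close>. With \<open>k = 2\<^sup>B + 1\<close> possible messages and more than \<open>k\<^sup>2\<close> blocks, two blocks lead to the
  same final messages between \<open>a\<close> and \<open>d\<close>, so these do not tell whether the blocks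
  of \<open>a\<close> and \<open>d\<close> coincide. The number of colours is \<open>k\<close> to a power polynomial in
  \<open>k\<close>, so a pool of size triply exponential in \<open>B\<close> suffices.\<close>

subsection \<open>Monochromatic quadruples\<close>

lemma large_fiber:
  assumes "finite X" "finite Q" "g ` X \<subseteq> Q" "card Q * k < card X"
  shows "\<exists>y\<in>Q. k < card {x\<in>X. g x = y}"
proof (rule ccontr)
  assume "\<not> ?thesis"
  then have "(\<Sum>y\<in>Q. card {x\<in>X. g x = y}) \<le> card Q * k"
    by (intro sum_bounded_above[where K = k, simplified]) (simp add: not_less)
  moreover have "X = (\<Union>y\<in>Q. {x\<in>X. g x = y})"
    using assms(3) by auto
  then have "card X \<le> (\<Sum>y\<in>Q. card {x\<in>X. g x = y})"
    using card_UN_le[OF assms(2), of "\<lambda>y. {x\<in>X. g x = y}"] by simp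
  ultimately show False using assms(4) by linarith
qed

text \<open>The greedy step of Ramsey's theorem: keep the minimum \<open>x\<close>, pass to a
  largest colour class of \<open>c x\<close> among the rest, and recurse. Each step costs a factor
  \<open>card Q\<close>.\<close>

lemma end_homogeneous_subset:
  fixes c :: "nat \<Rightarrow> nat \<Rightarrow> 'c"
  assumes "finite Q" "2 \<le> card Q" "\<And>x y. c x y \<in> Q" "finite S" "card Q ^ m \<le> card S"
  shows "\<exists>X\<subseteq>S. card X = m \<and> (\<exists>g. \<forall>x\<in>X. g x \<in> Q \<and> (\<forall>y\<in>X. x < y \<longrightarrow> c x y = g x))"
  using assms(4,5)
proof (induction m arbitrary: S)
  case 0
  then show ?case by (intro exI[of _ "{}"]) simp
next
  case (Suc m)
  let ?q = "card Q"
  have pos: "1 \<le> ?q ^ m" using assms(2) by (intro one_le_power) linarith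
  then have "1 \<le> card S" using Suc.prems(2) assms(2) by (simp add: order_trans[OF _ Suc.prems(2)])
  then have ne: "S \<noteq> {}" by auto
  define x where "x = Min S"
  have x: "x \<in> S" "\<And>y. y \<in> S \<Longrightarrow> x \<le> y" using ne Suc.prems(1) by (auto simp: x_def)
  \<comment> \<open>Removing \<open>x\<close> leaves at least \<open>?q ^ Suc m - 1\<close>
    elements, which exceeds \<open>?q ^ Suc m - ?q\<close> because \<open>?q\<close> is at least 2.
    A class with more than \<open>?q ^ m - 1\<close> elements has the size needed for the
    recursion.\<close>
  have "?q * (?q ^ m - 1) < card (S - {x})"
  proof -
    have "?q * (?q ^ m - 1) = ?q ^ Suc m - ?q" by (simp add: diff_mult_distrib2)
    moreover have "?q \<le> ?q ^ Suc m" using pos assms(2) by simp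
    moreover have "card (S - {x}) = card S - 1" using x(1) by simp
    ultimately show ?thesis using Suc.prems(2) assms(2) by linarith
  qed
  then obtain y where y: "y \<in> Q" "?q ^ m - 1 < card {z \<in> S - {x}. c x z = y}"
    using large_fiber[of "S - {x}" Q "c x" "?q ^ m - 1"] assms(1,3) Suc.prems(1) by auto
  define S' where "S' = {z \<in> S - {x}. c x z = y}"
  have "finite S'" "?q ^ m \<le> card S'" using y(2) Suc.prems(1) by (auto simp: S'_def)
  from Suc.IH[OF this] obtain X g where X: "X \<subseteq> S'" "card X = m"
    and g: "\<forall>x\<in>X. g x \<in> Q \<and> (\<forall>y\<in>X. x < y \<longrightarrow> c x y = g x)" by blast
  have fin: "finite X" using X(1) \<open>finite S'\<close> by (rule finite_subset)
  have xX: "x \<notin> X" using X(1) by (auto simp: S'_def)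
  show ?case
  proof (intro exI[of _ "insert x X"] conjI exI[of _ "g(x := y)"])
    show "insert x X \<subseteq> S" using X(1) x(1) by (auto simp: S'_def)
    show "card (insert x X) = Suc m" using fin xX X(2) by simp
    show "\<forall>z\<in>insert x X. (g(x := y)) z \<in> Q \<and>
      (\<forall>z'\<in>insert x X. z < z' \<longrightarrow> c z z' = (g(x := y)) z)"
    proof (intro ballI conjI impI)
      fix z assume z: "z \<in> insert x X"
      show "(g(x := y)) z \<in> Q" using z g y(1) by auto
      fix z' assume z': "z' \<in> insert x X" and lt: "z < z'"
      show "c z z' = (g(x := y)) z"
      proof (cases "z = x")
        case True
        then have "z' \<in> S'" using z' lt X(1) by auto
        then show ?thesis using True by (simp add: S'_def)
      next
        case False
        then have "x \<le> z" using z X(1) x(2) by (auto simp: S'_def)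
        then have "z' \<noteq> x" using lt by simp
        then show ?thesis using False z z' lt g by auto
      qed
    qed
  qed
qed

text \<open>Since \<open>f\<close> need not be symmetric, a pair is coloured by both of its values,
  with \<open>card Q ^ 2\<close> colours. In an end-homogeneous set of
  \<open>3 * card Q ^ 2 + 1\<close> elements four share the value of \<open>g\<close>, and in
  increasing order they serve as \<open>a\<close>, \<open>b\<close>, \<open>c\<close>,
  \<open>d\<close>.\<close>

lemma homogeneous_quadruple:
  fixes f :: "nat \<Rightarrow> nat \<Rightarrow> 'c"
  assumes "finite Q" "2 \<le> card Q" "\<And>x y. f x y \<in> Q" "finite S"
    and "(card Q ^ 2) ^ (3 * card Q ^ 2 + 1) \<le> card S"
  obtains a b c d where "{a, b, c, d} \<subseteq> S" "distinct [a, b, c, d]"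
    "f a b = f a d" "f a c = f a d" "f d b = f d a" "f d c = f d a"
proof -
  let ?c = "\<lambda>x y. (f x y, f y x)"
  have cQ: "card (Q \<times> Q) = card Q ^ 2" by (simp add: card_cartesian_product power2_eq_square)
  have "2 * 1 \<le> card Q * card Q" using assms(2) by (intro mult_le_mono) auto
  then have "2 \<le> card (Q \<times> Q)" by (simp add: card_cartesian_product)
  then obtain X g where X: "X \<subseteq> S" "card X = 3 * card Q ^ 2 + 1"
    and g: "\<forall>x\<in>X. g x \<in> Q \<times> Q \<and> (\<forall>y\<in>X. x < y \<longrightarrow> ?c x y = g x)"
    using end_homogeneous_subset[of "Q \<times> Q" ?c S "3 * card Q ^ 2 + 1"] assms cQ by auto
  have finX: "finite X" using X(1) assms(4) by (rule finite_subset)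
  have "card (Q \<times> Q) * 3 < card X" using X(2) cQ by simp
  moreover have "g ` X \<subseteq> Q \<times> Q" using g by blast
  ultimately obtain y where y: "3 < card {x\<in>X. g x = y}"
    using large_fiber[OF finX, of "Q \<times> Q" g 3] assms(1) by auto
  define Y where "Y = {x\<in>X. g x = y}"
  define xs where "xs = sorted_list_of_set Y"
  have Y: "finite Y" "set xs = Y" "3 < length xs" "sorted_wrt (<) xs"
    using finX y by (auto simp: Y_def xs_def)
  have "xs ! i \<in> Y" if "i < 4" for i using nth_mem[of i xs] Y(2,3) that by simp
  then have in_Y: "xs ! 0 \<in> Y" "xs ! 1 \<in> Y" "xs ! 2 \<in> Y" "xs ! 3 \<in> Y" by simp_all
  have lt: "xs ! 0 < xs ! 1" "xs ! 1 < xs ! 2" "xs ! 2 < xs ! 3"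
    using sorted_wrt_nth_less[OF Y(4), of 0 1] sorted_wrt_nth_less[OF Y(4), of 1 2]
      sorted_wrt_nth_less[OF Y(4), of 2 3] Y(3) by auto
  have eq: "?c p q = y" if "p \<in> Y" "q \<in> Y" "p < q" for p q
    using that g by (auto simp: Y_def)
  have "Y \<subseteq> S" using X(1) by (auto simp: Y_def)
  show ?thesis
  proof
    show "{xs ! 0, xs ! 1, xs ! 2, xs ! 3} \<subseteq> S" using in_Y \<open>Y \<subseteq> S\<close> by blast
    show "distinct [xs ! 0, xs ! 1, xs ! 2, xs ! 3]" using lt by auto
  qed (use eq[of "xs!0" "xs!1"] eq[of "xs!0" "xs!2"] eq[of "xs!0" "xs!3"] eq[of "xs!1" "xs!3"] eq[of "xs!2" "xs!3"] in_Y lt in auto)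
qed

subsection \<open>Messages and local views\<close>

text \<open>The index is shifted: this message is sent in round \<open>Suc t\<close>, after
  \<open>t\<close> completed rounds. It is defined for non-adjacent nodes too.\<close>

definition msg :: "algorithm \<Rightarrow> (nat \<Rightarrow> graph) \<Rightarrow> nat \<Rightarrow> nat \<Rightarrow> nat \<Rightarrow> message" where
  "msg A G t u v = send A (G 0) u (history_of A G t u) (neighbors (G (Suc t)) u) v"

definition messages :: "nat \<Rightarrow> message set" where
  "messages B = insert None (Some ` {m. length m = B})"

lemma card_messages: "finite (messages B)" "card (messages B) = 2 ^ B + 1"
proof -
  have fin: "finite {m :: bool list. length m = B}"
    using finite_lists_length_eq[of "UNIV :: bool set" B] by simp
  then show "finite (messages B)" by (simp add: messages_def)
  have "card {m :: bool list. length m = B} = 2 ^ B"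
    using card_lists_length_eq[of "UNIV :: bool set" B] by simp
  then have "card (Some ` {m :: bool list. length m = B}) = 2 ^ B" by (simp add: card_image)
  then show "card (messages B) = 2 ^ B + 1" using fin by (simp add: messages_def image_iff)
qed

lemma msg_in_messages:
  assumes "has_bandwidth A B"
  shows "msg A G t u v \<in> messages B"
proof (cases "msg A G t u v")
  case (Some m)
  then have "length m = B" using assms unfolding has_bandwidth_def msg_def by blast
  then show ?thesis using Some by (simp add: messages_def)
qed (simp add: messages_def)

section \<open>Propagation of indistinguishability\<close>

lemma history_Suc_cong:
  assumes "history_of A G t v = history_of A G' t v"
    and "v \<in> verts (G (Suc t)) \<longleftrightarrow> v \<in> verts (G' (Suc t))"
    and "neighbors (G (Suc t)) v = neighbors (G' (Suc t)) v"
    and "\<And>u. u \<in> neighbors (G (Suc t)) v \<Longrightarrow> msg A G t u v = msg A G' t u v"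
  shows "history_of A G (Suc t) v = history_of A G' (Suc t) v"
proof -
  have "(\<lambda>u. if u \<in> neighbors (G (Suc t)) v
             then send A (G 0) u (history_of A G t u) (neighbors (G (Suc t)) u) v else None) =
        (\<lambda>u. if u \<in> neighbors (G' (Suc t)) v
             then send A (G' 0) u (history_of A G' t u) (neighbors (G' (Suc t)) u) v else None)"
    using assms(3,4) by (auto simp: msg_def)
  then show ?thesis using assms(1,2,3) by simp
qed

text \<open>No edge leaves \<open>C\<close> during the first \<open>T\<close> rounds, so no
  information enters it, and induction on the rounds needs only the histories of senders in
  \<open>C\<close>.\<close>

lemma history_local:
  assumes "G 0 = G' 0"
    and "\<And>t v. t < T \<Longrightarrow> v \<in> C \<Longrightarrow> v \<in> verts (G (Suc t)) \<longleftrightarrow> v \<in> verts (G' (Suc t))"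
    and "\<And>t v. t < T \<Longrightarrow> v \<in> C \<Longrightarrow> neighbors (G (Suc t)) v = neighbors (G' (Suc t)) v"
    and "\<And>t v. t < T \<Longrightarrow> v \<in> C \<Longrightarrow> neighbors (G (Suc t)) v \<subseteq> C"
    and "t \<le> T" "v \<in> C"
  shows "history_of A G t v = history_of A G' t v"
  using assms(5,6)
proof (induction t arbitrary: v)
  case (Suc t)
  then have t: "t < T" by simp
  show ?case
  proof (rule history_Suc_cong)
    fix u assume "u \<in> neighbors (G (Suc t)) v"
    then have "u \<in> C" using assms(4)[OF t Suc.prems(2)] by blast
    then show "msg A G t u v = msg A G' t u v"
      using Suc.IH t assms(1,3) by (simp add: msg_def)
  qed (use Suc t assms(2,3) in auto)
qed simp

text \<open>A proper colouring is injective on a clique, so \<open>k\<close> colours leave no room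
  for \<open>s\<close> clique nodes.\<close>

lemma no_clique_if_coloured:
  assumes "\<And>u v. {u, v} \<in> edges G \<Longrightarrow> \<chi> u \<noteq> \<chi> v" "\<And>u. u \<in> verts G \<Longrightarrow> \<chi> u < k" "k < s"
  shows "\<not> contains_copy (clique s) G"
proof
  assume "contains_copy (clique s) G"
  then obtain f where f: "f ` {1..s} \<subseteq> verts G" "\<forall>e\<in>edges (clique s). f ` e \<in> edges G"
    unfolding contains_copy_def verts_clique by blast
  have "\<chi> (f i) \<noteq> \<chi> (f j)" if "i \<in> {1..s}" "j \<in> {1..s}" "i \<noteq> j" for i j
  proof -
    have "{i, j} \<in> edges (clique s)" using that by (auto simp: clique_def)
    then have "f ` {i, j} \<in> edges G" using f(2) by blast
    then show ?thesis using assms(1) by simp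
  qed
  then have "inj_on (\<chi> \<circ> f) {1..s}" by (force simp: inj_on_def)
  moreover have "(\<chi> \<circ> f) ` {1..s} \<subseteq> {..<k}" using f(1) assms(2) by auto
  ultimately have "card {1..s} \<le> card {..<k}" by (rule card_inj_on_le) simp
  then show False using assms(3) by simp
qed

lemma clique_copyI:
  assumes "finite K" "card K = s" "K \<subseteq> verts G"
    and "\<And>u v. u \<in> K \<Longrightarrow> v \<in> K \<Longrightarrow> u \<noteq> v \<Longrightarrow> {u, v} \<in> edges G"
  shows "contains_copy (clique s) G"
proof -
  obtain f where f: "bij_betw f {1..s} K"
    using ex_bij_betw_nat_finite_1[OF assms(1)] assms(2) by blast
  have "f ` e \<in> edges G" if "e \<in> edges (clique s)" for e
  proof -
    from that obtain i j where ij: "e = {i, j}" "i \<in> {1..s}" "j \<in> {1..s}" "i \<noteq> j"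
      by (auto simp: clique_def)
    have "f i \<in> K" "f j \<in> K" using f ij by (auto simp: bij_betw_def)
    moreover have "f i \<noteq> f j"
      using f ij by (auto simp: bij_betw_def dest: inj_onD)
    ultimately have "{f i, f j} \<in> edges G" by (rule assms(4))
    then show ?thesis using ij(1) by simp
  qed
  then show ?thesis
    using f assms(3) unfolding contains_copy_def verts_clique bij_betw_def by (intro exI[of _ f]) simp
qed

section \<open>Graphs cut out of a relation\<close>

definition induced :: "nat set \<Rightarrow> (nat \<Rightarrow> nat \<Rightarrow> bool) \<Rightarrow> graph" where
  "induced V R = (V, {{u, v} | u v. u \<in> V \<and> v \<in> V \<and> R u v})"

lemma edges_induced:
  assumes "symp R"
  shows "{u, v} \<in> edges (induced V R) \<longleftrightarrow> u \<in> V \<and> v \<in> V \<and> R u v"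
  using assms by (auto simp: induced_def doubleton_eq_iff dest: sympD)

lemma simple_graph_induced:
  assumes "finite V" "\<And>u. \<not> R u u"
  shows "simple_graph (induced V R)"
proof -
  have neq: "u \<noteq> v" if "R u v" for u v using assms(2)[of u] that by auto
  have "e \<in> {{u, v} | u v. u \<in> V \<and> v \<in> V \<and> u \<noteq> v}" if "e \<in> edges (induced V R)" for e
    using that neq unfolding induced_def snd_conv by blast
  then show ?thesis
    using assms(1) unfolding simple_graph_def by (simp add: induced_def subset_iff)
qed

lemma edge_insertion_induced:
  assumes "symp R" "u \<in> V" "v \<in> V" "u \<noteq> v" "\<not> R u v"
    and "\<And>y z. R' y z \<longleftrightarrow> R y z \<or> {y, z} = {u, v}"
  shows "edge_insertion (induced V R) (induced V R')"
  unfolding edge_insertion_def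
proof (intro exI conjI)
  show "u \<in> verts (induced V R)" "v \<in> verts (induced V R)" "u \<noteq> v"
    using assms by (simp_all add: induced_def)
  show "{u, v} \<notin> edges (induced V R)" using assms by (simp add: edges_induced)
  have "e \<in> edges (induced V R') \<longleftrightarrow> e = {u, v} \<or> e \<in> edges (induced V R)" for e
  proof
    assume "e \<in> edges (induced V R')"
    then obtain y z where "e = {y, z}" "y \<in> V" "z \<in> V" "R' y z" by (auto simp: induced_def)
    then show "e = {u, v} \<or> e \<in> edges (induced V R)"
      using assms(6)[of y z] by (auto simp: induced_def)
  next
    assume "e = {u, v} \<or> e \<in> edges (induced V R)"
    then consider "e = {u, v}" | y z where "e = {y, z}" "y \<in> V" "z \<in> V" "R y z"
      by (auto simp: induced_def)
    then show "e \<in> edges (induced V R')"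
    proof cases
      case 1
      then show ?thesis using assms(2,3) assms(6)[of u v] by (auto simp: induced_def)
    next
      case 2
      then show ?thesis using assms(6)[of y z] by (auto simp: induced_def)
    qed
  qed
  then have "edges (induced V R') = insert {u, v} (edges (induced V R))" by auto
  then show "induced V R' = (verts (induced V R), insert {u, v} (edges (induced V R)))"
    by (simp add: induced_def)
qed

text \<open>The relations need to agree only on the old nodes: in the final round the delayed node
  brings along the edges of \<open>F\<close>, all of which contain it.\<close>

lemma node_insertion_induced:
  assumes "symp R'" "p \<notin> V" "\<not> R' p p" "\<And>u v. u \<in> V \<Longrightarrow> v \<in> V \<Longrightarrow> R' u v \<longleftrightarrow> R u v"
  shows "node_insertion (induced V R) (induced (insert p V) R')"
  unfolding node_insertion_def
proof (intro exI conjI)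
  let ?S = "{u \<in> V. R' p u}"
  show "p \<notin> verts (induced V R)" "?S \<subseteq> verts (induced V R)"
    using assms(2) by (auto simp: induced_def)
  have "e \<in> edges (induced (insert p V) R') \<longleftrightarrow>
    e \<in> edges (induced V R) \<or> (\<exists>u. e = {p, u} \<and> u \<in> ?S)" for e
  proof
    assume "e \<in> edges (induced (insert p V) R')"
    then obtain u v where e: "e = {u, v}" "u \<in> insert p V" "v \<in> insert p V" "R' u v"
      by (auto simp: induced_def)
    then consider "u \<in> V" "v \<in> V" | "u = p" "v \<in> V" | "v = p" "u \<in> V" using assms(3) by auto
    then show "e \<in> edges (induced V R) \<or> (\<exists>u. e = {p, u} \<and> u \<in> ?S)"
    proof cases
      case 1
      then show ?thesis using e assms(4)[of u v] by (auto simp: induced_def)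
    next
      case 2
      then show ?thesis using e by auto
    next
      case 3
      then have "e = {p, u}" "R' p u" using e assms(1) by (auto dest: sympD)
      then show ?thesis using 3 by auto
    qed
  next
    assume "e \<in> edges (induced V R) \<or> (\<exists>u. e = {p, u} \<and> u \<in> ?S)"
    then consider u v where "e = {u, v}" "u \<in> V" "v \<in> V" "R u v"
      | u where "e = {p, u}" "u \<in> V" "R' p u"
      by (auto simp: induced_def)
    then show "e \<in> edges (induced (insert p V) R')"
    proof cases
      case 1
      then show ?thesis using assms(4)[of u v] by (auto simp: induced_def)
    next
      case 2
      then show ?thesis by (auto simp: induced_def)
    qed
  qed
  then have "edges (induced (insert p V) R') = edges (induced V R) \<union> {{p, u} | u. u \<in> ?S}"
    by auto
  then show "induced (insert p V) R' =
    (insert p (verts (induced V R)), edges (induced V R) \<union> {{p, u} | u. u \<in> ?S})"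
    by (simp add: induced_def)
qed

subsection \<open>Networks built from a pool and blocks\<close>

text \<open>Nodes \<open>1, \<dots>, N\<close> form the pool, and the remaining nodes up to \<open>n\<close> form
  \<open>I\<close> blocks of size \<open>r\<close>. Node \<open>p\<close> is inserted in round \<open>p\<close>, except that the nodes in
  \<open>X\<close> are delayed until the final round \<open>n + 1\<close>, where also the edges in \<open>F\<close> appear. The map
  \<open>att\<close> assigns to a pool node the block that it is attached to.\<close>

locale block_networks =
  fixes N r I n :: nat
  assumes r: "1 \<le> r" and n: "n = N + I * r"
begin

text \<open>Identifiers start at 1, so block 0 starts at \<open>Suc N\<close>. Truncated subtraction
  puts pool nodes into block 0 as well, hence the guards \<open>N < w\<close> in what
  follows.\<close>

definition block :: "nat \<Rightarrow> nat" where
  "block w = (w - Suc N) div r"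

definition members :: "nat \<Rightarrow> nat set" where
  "members i = {w. N < w \<and> block w = i}"

text \<open>Two pool nodes are never related here; edges between them come only from
  \<open>F\<close>.\<close>

definition adj :: "(nat \<Rightarrow> nat option) \<Rightarrow> nat \<Rightarrow> nat \<Rightarrow> bool" where
  "adj att u v \<longleftrightarrow> u \<noteq> v \<and> N < u \<and> N < v \<and> block u = block v
     \<or> N < u \<and> v \<le> N \<and> att v = Some (block u) \<or> N < v \<and> u \<le> N \<and> att u = Some (block v)"

definition present :: "nat set \<Rightarrow> nat \<Rightarrow> nat set" where
  "present X t = {p \<in> {1..n}. p \<le> t \<and> (p \<in> X \<longrightarrow> n < t)}"

definition net :: "(nat \<Rightarrow> nat option) \<Rightarrow> nat set \<Rightarrow> nat set set \<Rightarrow> nat \<Rightarrow> graph" where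
  "net att X F t = induced (present X t) (\<lambda>u v. adj att u v \<or> n < t \<and> {u, v} \<in> F)"

lemma N_le: "N \<le> n"
  by (simp add: n)

lemma members_eq: "members i = {N + i * r <.. N + i * r + r}"
proof (intro set_eqI iffI)
  fix w assume "w \<in> members i"
  then have w: "N < w" "(w - Suc N) div r = i" by (simp_all add: members_def block_def)
  have "i * r + (w - Suc N) mod r = w - Suc N" using div_mult_mod_eq[of "w - Suc N" r] w(2) by simp
  moreover have "(w - Suc N) mod r < r" using r by simp
  ultimately have "N + i * r < w" "w \<le> N + i * r + r" using w(1) by linarith+
  then show "w \<in> {N + i * r<..N + i * r + r}" by simp
next
  fix w assume "w \<in> {N + i * r<..N + i * r + r}"
  then have "N + i * r < w" "w \<le> N + i * r + r" by simp_all
  then have w: "N < w" "r * i \<le> w - Suc N" "w - Suc N < r * Suc i"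
    by (simp_all add: mult.commute)
  then have "(w - Suc N) div r = i" by (intro div_nat_eqI)
  then show "w \<in> members i" using w(1) by (simp add: members_def block_def)
qed

lemma members_subset:
  assumes "i < I" shows "members i \<subseteq> {N<..n}"
proof -
  have "Suc i * r \<le> I * r" using assms by (intro mult_le_mono1) simp
  then show ?thesis by (auto simp: members_eq n)
qed

lemma card_members: "card (members i) = r" "finite (members i)"
  by (simp_all add: members_eq)

text \<open>Block and offset determine a block node. The offsets properly colour each block with
  \<open>r\<close> colours in the clique-free networks below.\<close>

lemma offset_neq:
  assumes "N < u" "N < v" "u \<noteq> v" "block u = block v"
  shows "(u - Suc N) mod r \<noteq> (v - Suc N) mod r"
proof
  assume "(u - Suc N) mod r = (v - Suc N) mod r"
  then have "u - Suc N = v - Suc N"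
    using assms(4) unfolding block_def by (metis div_mult_mod_eq)
  then show False using assms by simp
qed

lemma symp_net: "symp (\<lambda>u v. adj att u v \<or> n < t \<and> {u, v} \<in> F)"
  by (auto simp: symp_def adj_def insert_commute)

lemma verts_net: "verts (net att X F t) = present X t"
  by (simp add: net_def induced_def)

lemma edges_net:
  "{u, v} \<in> edges (net att X F t) \<longleftrightarrow>
     u \<in> present X t \<and> v \<in> present X t \<and> (adj att u v \<or> n < t \<and> {u, v} \<in> F)"
  unfolding net_def edges_induced[OF symp_net] ..

lemma neighbors_net:
  "neighbors (net att X F t) v =
     {u. u \<in> present X t \<and> v \<in> present X t \<and> (adj att u v \<or> n < t \<and> {u, v} \<in> F)}"
  by (simp add: neighbors_def edges_net)

lemma present_early: "t \<le> n \<Longrightarrow> present X t = {1..t} - X"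
  by (auto simp: present_def)

lemma present_final: "present X (Suc n) = {1..n}"
  by (auto simp: present_def)

lemma neighbors_early:
  "t \<le> n \<Longrightarrow> neighbors (net att X F t) v = {u \<in> {1..t} - X. v \<in> {1..t} - X \<and> adj att u v}"
  by (auto simp: neighbors_net present_early)

lemma neighbors_final:
  "neighbors (net att X F (Suc n)) v = {u \<in> {1..n}. v \<in> {1..n} \<and> (adj att u v \<or> {u, v} \<in> F)}"
  by (auto simp: neighbors_net present_final)

lemma adj_pool: "v \<le> N \<Longrightarrow> adj att u v \<longleftrightarrow> (\<exists>i. att v = Some i \<and> u \<in> members i)"
  by (auto simp: adj_def members_def)

lemma adj_member:
  "v \<in> members i \<Longrightarrow> adj att u v \<longleftrightarrow> u \<noteq> v \<and> u \<in> members i \<or> u \<le> N \<and> att u = Some i"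
  by (auto simp: adj_def members_def)

lemma adj_commute: "adj att u v \<longleftrightarrow> adj att v u"
  by (auto simp: adj_def)

lemma net_0: "net att X F 0 = ({}, {})"
  by (simp add: net_def induced_def present_def)

lemma present_Suc:
  "Suc t \<le> n \<Longrightarrow> present X (Suc t) = (if Suc t \<in> X then present X t else insert (Suc t) (present X t))"
  by (auto simp: present_def le_Suc_eq)

text \<open>Each round up to \<open>n\<close> inserts one node or, at the turn of a delayed node, is
  idle. The hypothesis on \<open>X\<close> and \<open>F\<close> makes the final round a single
  change: one pool edge, or one delayed node bringing all its edges.\<close>

lemma net_dynamic:
  assumes F: "\<And>e. e \<in> F \<Longrightarrow> \<exists>u v. e = {u, v} \<and> u \<noteq> v \<and> u \<in> {1..N} \<and> v \<in> {1..N}"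
    and final: "(\<exists>e. X = {} \<and> F = {e}) \<or> (\<exists>x\<in>{1..N}. X = {x} \<and> (\<forall>e\<in>F. x \<in> e))"
  shows "net att X F \<in> dynamic_networks n"
  unfolding dynamic_networks_def
proof (intro CollectI conjI allI)
  have F1: "{u} \<notin> F" for u using F[of "{u}"] by (auto simp: doubleton_eq_iff)
  have irr: "\<not> (adj att u u \<or> n < t \<and> {u, u} \<in> F)" for u t
    using F1[of u] by (auto simp: adj_def)
  show "simple_graph (net att X F t)" for t
    unfolding net_def by (rule simple_graph_induced[OF _ irr]) (simp add: present_def)
  show "(\<Union>t. verts (net att X F t)) = {1..n}"
  proof -
    have "verts (net att X F (Suc n)) = {1..n}" by (simp add: verts_net present_final)
    moreover have "verts (net att X F t) \<subseteq> {1..n}" for t by (auto simp: verts_net present_def)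
    ultimately show ?thesis by blast
  qed
  fix t
  consider "Suc t \<le> n" | "t = n" | "n < t" by linarith
  then show "net att X F (Suc t) = net att X F t \<or> edge_insertion (net att X F t) (net att X F (Suc t)) \<or>
    node_insertion (net att X F t) (net att X F (Suc t))"
  proof cases
    case 1
    show ?thesis
    proof (cases "Suc t \<in> X")
      case True
      then have "net att X F (Suc t) = net att X F t" using 1 by (simp add: net_def present_Suc)
      then show ?thesis ..
    next
      case False
      have "node_insertion (net att X F t) (net att X F (Suc t))"
        unfolding net_def present_Suc[OF 1] if_not_P[OF False]
        by (rule node_insertion_induced[OF symp_net _ irr]) (use 1 in \<open>auto simp: present_def\<close>)
      then show ?thesis by blast
    qed
  next
    case 2
    from final show ?thesis
    proof (elim disjE exE bexE conjE)
      fix e assume X: "X = {}" and e: "F = {e}"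
      then obtain u v where uv: "e = {u, v}" "u \<noteq> v" "u \<in> {1..N}" "v \<in> {1..N}" using F by blast
      have P: "present X (Suc n) = {1..n}" "present X n = {1..n}"
        using X by (simp_all add: present_final present_early)
      have "edge_insertion (net att X F n) (net att X F (Suc n))"
        unfolding net_def P
      proof (rule edge_insertion_induced[OF symp_net])
        show "u \<in> {1..n}" "v \<in> {1..n}" "u \<noteq> v" using uv N_le by auto
        \<comment> \<open>Both ends lie in the pool, so the edge is new.\<close>
        show "\<not> (adj att u v \<or> n < n \<and> {u, v} \<in> F)" using uv by (auto simp: adj_def)
      qed (simp add: e uv(1))
      then show ?thesis using 2 by simp
    next
      fix x assume x: "x \<in> {1..N}" "X = {x}" "\<forall>e\<in>F. x \<in> e"
      have P: "present X (Suc n) = insert x (present X n)" using x N_le by (auto simp: present_def)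
      have out: "x \<notin> present X n" using x(2) by (simp add: present_def)
      have "node_insertion (net att X F n) (net att X F (Suc n))"
        unfolding net_def P
      proof (rule node_insertion_induced[OF symp_net out])
        show "\<not> (adj att x x \<or> n < Suc n \<and> {x, x} \<in> F)" by (rule irr)
        fix u v assume uv: "u \<in> present X n" "v \<in> present X n"
        have "{u, v} \<notin> F"
        proof
          assume "{u, v} \<in> F"
          then have "x \<in> {u, v}" by (rule bspec[OF x(3)])
          then show False using uv out by auto
        qed
        then show "(adj att u v \<or> n < Suc n \<and> {u, v} \<in> F) \<longleftrightarrow> (adj att u v \<or> n < n \<and> {u, v} \<in> F)"
          by simp
      qed
      then show ?thesis using 2 by simp
    qed
  next
    case 3
    then have "present X (Suc t) = present X t" by (auto simp: present_def)
    then show ?thesis using 3 by (simp add: net_def)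
  qed
qed

text \<open>The neighbors of a node lie in one block, of size \<open>r\<close>, and in the set
  \<open>K\<close> of attached nodes and ends of final edges.\<close>

lemma net_bounded_degree:
  assumes "net att X F \<in> dynamic_networks n"
    and K: "{p. att p \<noteq> None} \<subseteq> K" "\<Union>F \<subseteq> K" "finite K" "card K \<le> 4"
  shows "net att X F \<in> bounded_degree_networks (r + 4) n"
  unfolding bounded_degree_networks_def
proof (intro CollectI conjI allI ballI)
  fix t v
  \<comment> \<open>For an unattached pool node \<open>the (att v)\<close> is unspecified, which is
    harmless: \<open>members\<close> has \<open>r\<close> elements at every argument.\<close>
  let ?M = "members (if N < v then block v else the (att v))"
  have "neighbors (net att X F t) v \<subseteq> ?M \<union> K"
  proof
    fix u assume "u \<in> neighbors (net att X F t) v"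
    then consider "adj att u v" | "{u, v} \<in> F" by (auto simp: neighbors_net)
    then show "u \<in> ?M \<union> K"
    proof cases
      case 1
      then consider "N < u" "N < v" "block u = block v" | "N < u" "\<not> N < v" "att v = Some (block u)"
        | "att u = Some (block v)" by (auto simp: adj_def)
      then show ?thesis
      proof cases
        case 3
        then have "u \<in> {p. att p \<noteq> None}" by simp
        then show ?thesis using K(1) by blast
      qed (simp_all add: members_def)
    next
      case 2
      then have "u \<in> \<Union>F" by blast
      then show ?thesis using K(2) by blast
    qed
  qed
  then have "card (neighbors (net att X F t) v) \<le> card (?M \<union> K)"
    using K(3) by (intro card_mono) (simp_all add: card_members)
  also have "\<dots> \<le> r + 4" using card_Un_le[of ?M K] K(4) by (simp only: card_members)
  finally show "card (neighbors (net att X F t) v) \<le> r + 4" .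
qed (rule assms)

end

subsection \<open>Indistinguishable networks\<close>

locale one_round = block_networks +
  fixes A :: algorithm
begin

definition joined :: "nat \<Rightarrow> nat \<Rightarrow> nat \<Rightarrow> nat \<Rightarrow> graph" where
  "joined i u v = net (\<lambda>z. if z \<in> {u, v} then Some i else None) {} {{u, v}}"

text \<open>The clique-free counterpart of \<open>joined\<close> for nodes outside
  \<open>{u, v}\<close>: in place of the edge, the delayed pool node \<open>x\<close> arrives as a
  common neighbor of \<open>u\<close> and \<open>v\<close>.\<close>

definition witnessed :: "nat \<Rightarrow> nat \<Rightarrow> nat \<Rightarrow> nat \<Rightarrow> nat \<Rightarrow> graph" where
  "witnessed i u v x = net (\<lambda>z. if z \<in> {u, v} then Some i else None) {x} {{x, u}, {x, v}}"

text \<open>The clique-free counterpart of \<open>joined\<close> for \<open>u\<close> and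
  \<open>v\<close> themselves. The nodes \<open>p\<close> and \<open>q\<close> are stand-ins: block
  \<open>i\<close> sees \<open>p\<close> in place of \<open>v\<close>, and block \<open>j\<close>
  sees \<open>q\<close> in place of \<open>u\<close>.\<close>

definition separated :: "nat \<Rightarrow> nat \<Rightarrow> nat \<Rightarrow> nat \<Rightarrow> nat \<Rightarrow> nat \<Rightarrow> nat \<Rightarrow> graph" where
  "separated i j u p v q = net (\<lambda>z. if z \<in> {u, p} then Some i else if z \<in> {v, q} then Some j else None)
     {} {{u, v}}"

text \<open>An index consists of a block, a time, a block node and a direction. Time
  \<open>t\<close> belongs to round \<open>Suc t\<close>, and block nodes appear only from round
  \<open>Suc N\<close> on, so \<open>{N..n}\<close> covers all rounds that matter, including the
  final one.\<close>

definition traffic_index :: "(nat \<times> nat \<times> nat \<times> bool) set" where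
  "traffic_index = {..<I} \<times> {N..n} \<times> {N<..n} \<times> UNIV"

text \<open>The colour of an unordered pair \<open>{u, v}\<close> in the Ramsey argument is the pair of
  \<open>traffic u v\<close> and \<open>traffic v u\<close>. Since the neighbors of \<open>u\<close> before the final round do not
  depend on \<open>v\<close>, neither does the history of \<open>u\<close> up to then among the \<open>v\<close> with equal traffic.\<close>

definition traffic :: "nat \<Rightarrow> nat \<Rightarrow> nat \<times> nat \<times> nat \<times> bool \<Rightarrow> message" where
  "traffic u v = restrict (\<lambda>(i, t, w, out).
     if out then msg A (joined i u v) t u w else msg A (joined i u v) t w u) traffic_index"

lemma joined_commute: "joined i u v = joined i v u"
  by (simp add: joined_def insert_commute)

lemma traffic_eqD:
  assumes "traffic u v = traffic u x" "i < I" "N \<le> t" "t \<le> n" "N < w" "w \<le> n"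
  shows "msg A (joined i u v) t u w = msg A (joined i u x) t u w"
    and "msg A (joined i u v) t w u = msg A (joined i u x) t w u"
  using fun_cong[OF assms(1), of "(i, t, w, True)"] fun_cong[OF assms(1), of "(i, t, w, False)"]
    assms(2-) by (simp_all add: traffic_def traffic_index_def)

lemma neighbors_pool:
  assumes "u \<in> {1..N}"
  shows "neighbors (net att X F t) u = {w. u \<in> present X t \<and> w \<in> present X t \<and>
    ((\<exists>i. att u = Some i \<and> w \<in> members i) \<or> n < t \<and> {w, u} \<in> F)}"
  using assms by (auto simp: neighbors_net adj_def members_def)

lemma history_joined_cong:
  assumes eq: "traffic u v = traffic u x" and i: "i < I"
    and u: "u \<in> {1..N}"
    and "t \<le> n"
  shows "history_of A (joined i u v) t u = history_of A (joined i u x) t u"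
  using assms(4)
proof (induction t)
  case (Suc t)
  show ?case
  proof (rule history_Suc_cong)
    show "neighbors (joined i u v (Suc t)) u = neighbors (joined i u x (Suc t)) u"
      using Suc.prems by (simp add: joined_def neighbors_pool[OF u])
    fix w assume "w \<in> neighbors (joined i u v (Suc t)) u"
    then have "w \<in> members i" "w \<le> Suc t" "w \<le> n"
      using Suc.prems by (auto simp: joined_def neighbors_pool[OF u] present_def)
    \<comment> \<open>A block node present in round \<open>Suc t\<close> forces
      \<open>N \<le> t\<close>, so its message is recorded in \<open>traffic\<close>.\<close>
    then have "N < w" "w \<le> n" "N \<le> t" by (auto simp: members_def)
    then show "msg A (joined i u v) t w u = msg A (joined i u x) t w u"
      using traffic_eqD(2)[OF eq i] Suc.prems by simp
  qed (use Suc in \<open>simp_all add: joined_def verts_net\<close>)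
qed simp

text \<open>Before the final round \<open>x\<close> is isolated in \<open>joined\<close>, so nobody
  else notices that it is delayed.\<close>

lemma history_witnessed:
  assumes x: "x \<in> {1..N}" "x \<noteq> u" "x \<noteq> v" and "z \<noteq> x" "t \<le> n"
  shows "history_of A (joined i u v) t z = history_of A (witnessed i u v x) t z"
proof (rule history_local[where C = "- {x}" and T = n])
  let ?att = "\<lambda>z. if z \<in> {u, v} then Some i else None"
  have iso: "\<not> adj ?att x z" for z
    using x by (subst adj_commute) (simp add: adj_pool)
  fix t w assume "t < n" "w \<in> - {x}"
  then have t: "Suc t \<le> n" and w: "w \<noteq> x" by simp_all
  show "w \<in> verts (joined i u v (Suc t)) \<longleftrightarrow> w \<in> verts (witnessed i u v x (Suc t))"
    using w by (simp add: joined_def witnessed_def verts_net present_early[OF t])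
  show "neighbors (joined i u v (Suc t)) w = neighbors (witnessed i u v x (Suc t)) w"
    unfolding joined_def witnessed_def neighbors_early[OF t] using iso w by auto
  show "neighbors (joined i u v (Suc t)) w \<subseteq> - {x}"
    unfolding joined_def neighbors_early[OF t] using iso by auto
qed (use assms in \<open>simp_all add: joined_def witnessed_def net_0\<close>)

text \<open>Before the final round \<open>u\<close>, \<open>p\<close> and block \<open>i\<close>
  have no neighbors outside their own set, so block \<open>j\<close> stays invisible to
  them.\<close>

lemma history_separated:
  assumes dist: "distinct [u, p, v, q]" and pool: "{u, p, v, q} \<subseteq> {1..N}" and ij: "i \<noteq> j"
    and "z \<in> {u, p} \<union> members i" "t \<le> n"
  shows "history_of A (separated i j u p v q) t z = history_of A (joined i u p) t z"
proof (rule history_local[where C = "{u, p} \<union> members i" and T = n])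
  let ?att = "\<lambda>z. if z \<in> {u, p} then Some i else None"
  let ?att' = "\<lambda>z. if z \<in> {u, p} then Some i else if z \<in> {v, q} then Some j else None"
  fix t w assume "t < n" and w: "w \<in> {u, p} \<union> members i"
  then have t: "Suc t \<le> n" by simp
  have adj: "(adj ?att y w \<longleftrightarrow> adj ?att' y w) \<and> (adj ?att y w \<longrightarrow> y \<in> {u, p} \<union> members i)" for y
  proof (cases "w \<in> members i")
    case True
    show ?thesis unfolding adj_member[OF True] using ij by simp
  next
    case False
    then have "w \<le> N" "w \<in> {u, p}" using w pool by auto
    then show ?thesis by (simp add: adj_pool)
  qed
  show "w \<in> verts (separated i j u p v q (Suc t)) \<longleftrightarrow> w \<in> verts (joined i u p (Suc t))"
    by (simp add: joined_def separated_def verts_net)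
  show "neighbors (separated i j u p v q (Suc t)) w = neighbors (joined i u p (Suc t)) w"
    unfolding joined_def separated_def neighbors_early[OF t] using adj by simp
  show "neighbors (separated i j u p v q (Suc t)) w \<subseteq> {u, p} \<union> members i"
    unfolding separated_def neighbors_early[OF t] using adj by blast
qed (use assms in \<open>simp_all add: joined_def separated_def net_0\<close>)

lemma separated_commute:
  assumes "distinct [u, p, v, q]"
  shows "separated i j u p v q = separated j i v q u p"
proof -
  have "(\<lambda>z. if z \<in> {u, p} then Some i else if z \<in> {v, q} then Some j else None) =
    (\<lambda>z. if z \<in> {v, q} then Some j else if z \<in> {u, p} then Some i else None)"
    using assms by auto
  then show ?thesis by (simp add: separated_def insert_commute)
qed

text \<open>The final message of \<open>z \<in> {u, v}\<close> to its block in \<open>witnessed i u v x\<close> is the one in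
  \<open>joined i z x\<close>, because \<open>z\<close> sees the same in both networks.\<close>

lemma witnessed_view:
  assumes u: "u \<in> {1..N}" and v: "v \<in> {1..N}" and x: "x \<in> {1..N}"
    and dist: "u \<noteq> v" "x \<noteq> u" "x \<noteq> v" "y \<notin> {u, v, x}" and i: "i < I"
    and eq: "traffic u x = traffic u v" "traffic v x = traffic v u"
  shows "history_of A (witnessed i u v x) (Suc n) y = history_of A (joined i u v) (Suc n) y"
proof (rule history_Suc_cong)
  let ?H = "joined i u v" and ?K = "witnessed i u v x"
  have key: "msg A ?K n z w = msg A ?H n z w"
    if z: "z \<in> {u, v}" and z': "z' \<in> {u, v}" "z' \<noteq> z" and w: "w \<in> members i" for z z' w
  proof -
    have zN: "z \<in> {1..N}" using z u v by auto
    have eqz: "traffic z x = traffic z z'" using eq z z' by auto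
    have Hz: "?H = joined i z z'" using z z' joined_commute by auto
    have w': "N < w" "w \<le> n" using w members_subset[OF i] by auto
    \<comment> \<open>In its neighbor list \<open>z\<close> cannot tell the insertion of the node
      \<open>x\<close> from that of the edge \<open>{z, x}\<close>.\<close>
    have nbr: "neighbors (?K (Suc n)) z = neighbors (joined i z x (Suc n)) z"
      using z z' dist zN x N_le by (auto simp: witnessed_def joined_def neighbors_pool present_def doubleton_eq_iff)
    have "history_of A ?K n z = history_of A ?H n z"
      by (rule history_witnessed[symmetric]) (use x dist z in auto)
    also have "\<dots> = history_of A (joined i z x) n z"
      unfolding Hz by (rule history_joined_cong[OF eqz[symmetric] i zN]) simp
    finally have "msg A ?K n z w = msg A (joined i z x) n z w"
      by (simp add: msg_def nbr) (simp add: witnessed_def joined_def net_0)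
    also have "\<dots> = msg A ?H n z w"
      unfolding Hz using traffic_eqD(1)[OF eqz i _ _ w'] N_le by simp
    finally show ?thesis .
  qed
  show "history_of A ?K n y = history_of A ?H n y"
    by (rule history_witnessed[symmetric]) (use x dist in auto)
  show "y \<in> verts (?K (Suc n)) \<longleftrightarrow> y \<in> verts (?H (Suc n))"
    by (auto simp: witnessed_def joined_def verts_net present_def)
  show "neighbors (?K (Suc n)) y = neighbors (?H (Suc n)) y"
    using dist x by (auto simp: witnessed_def joined_def neighbors_net present_def adj_def doubleton_eq_iff)
  fix z assume z: "z \<in> neighbors (?K (Suc n)) y"
  show "msg A ?K n z y = msg A ?H n z y"
  \<comment> \<open>From \<open>u\<close> or \<open>v\<close> only block nodes can be reached here,
    which \<open>key\<close> covers. Any other sender differs from \<open>x\<close> and has the same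
    history and final neighbors in both networks.\<close>
  proof (cases "z \<in> {u, v}")
    case True
    then have "y \<in> members i"
      using z dist u v by (auto simp: witnessed_def neighbors_net adj_def members_def doubleton_eq_iff)
    then show ?thesis using key[of z "if z = u then v else u" y] True dist(1) by auto
  next
    case False
    then have zx: "z \<noteq> x"
      using z dist x by (auto simp: witnessed_def neighbors_net adj_def doubleton_eq_iff)
    have "neighbors (?K (Suc n)) z = neighbors (?H (Suc n)) z"
      using False zx dist x by (auto simp: witnessed_def joined_def neighbors_net present_def adj_def doubleton_eq_iff)
    moreover have "history_of A ?K n z = history_of A ?H n z"
      by (rule history_witnessed[symmetric]) (use x dist zx in auto)
    ultimately show ?thesis by (simp add: msg_def) (simp add: witnessed_def joined_def net_0)
  qed
qed

text \<open>Block \<open>i\<close> behaves towards \<open>u\<close> as in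
  \<open>joined i u p\<close>, hence as in \<open>joined i u v\<close> by equal traffic. Likewise
  \<open>v\<close> is in the state it has in \<open>joined j u v\<close>, and \<open>final\<close>
  says that its last message does not reveal whether its block is \<open>j\<close> or
  \<open>i\<close>.\<close>

lemma separated_view:
  assumes in_pool: "{u, p, v, q} \<subseteq> {1..N}" and dist: "distinct [u, p, v, q]"
    and ij: "i < I" "j < I" "i \<noteq> j"
    and eq: "traffic u p = traffic u v" "traffic v q = traffic v u"
    and final: "msg A (joined j u v) n v u = msg A (joined i u v) n v u"
  shows "history_of A (separated i j u p v q) (Suc n) u = history_of A (joined i u v) (Suc n) u"
proof (rule history_Suc_cong)
  let ?H = "joined i u v" and ?C = "separated i j u p v q"
  have u: "u \<in> {1..N}" and v: "v \<in> {1..N}" using in_pool by auto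
  have dist': "distinct [v, q, u, p]" and in_pool': "{v, q, u, p} \<subseteq> {1..N}"
    using dist in_pool by auto
  have hist_v: "history_of A ?C n v = history_of A (joined j u v) n v"
  proof -
    have "history_of A ?C n v = history_of A (joined j v q) n v"
      unfolding separated_commute[OF dist]
      by (rule history_separated[OF dist' in_pool']) (use ij in auto)
    also have "\<dots> = history_of A (joined j v u) n v"
      by (rule history_joined_cong[OF eq(2) ij(2) v]) simp
    finally show ?thesis by (simp add: joined_commute)
  qed
  show "history_of A ?C n u = history_of A ?H n u"
  proof -
    have "history_of A ?C n u = history_of A (joined i u p) n u"
      by (rule history_separated[OF dist in_pool ij(3)]) auto
    also have "\<dots> = history_of A ?H n u"
      by (rule history_joined_cong[OF eq(1) ij(1) u]) simp
    finally show ?thesis .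
  qed
  show "u \<in> verts (?C (Suc n)) \<longleftrightarrow> u \<in> verts (?H (Suc n))"
    by (simp add: separated_def joined_def verts_net)
  show "neighbors (?C (Suc n)) u = neighbors (?H (Suc n)) u"
    by (simp add: separated_def joined_def neighbors_pool[OF u])
  fix z assume "z \<in> neighbors (?C (Suc n)) u"
  then consider "z = v" | "z \<in> members i" "z \<le> n"
    using dist by (auto simp: separated_def neighbors_pool[OF u] present_def doubleton_eq_iff)
  then show "msg A ?C n z u = msg A ?H n z u"
  proof cases
    case 1
    have "neighbors (?C (Suc n)) v = neighbors (joined j u v (Suc n)) v"
      using dist by (auto simp: separated_def joined_def neighbors_pool[OF v])
    then have "msg A ?C n v u = msg A (joined j u v) n v u"
      by (simp add: msg_def hist_v) (simp add: separated_def joined_def net_0)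
    then show ?thesis using final 1 by simp
  next
    case 2
    \<comment> \<open>Block nodes are not incident with the final edge, so even in the final round
      they see the same neighbors as in \<open>joined i u p\<close>.\<close>
    have "z \<notin> {u, v, p}" using 2(1) in_pool by (auto simp: members_def)
    then have "{y, z} \<notin> {{u, v}}" "{y, z} \<notin> {{u, p}}" for y by (auto simp: doubleton_eq_iff)
    moreover have "(if y \<in> {u, p} then Some i else if y \<in> {v, q} then Some j else None) = Some i \<longleftrightarrow>
      (if y \<in> {u, p} then Some i else None) = Some i" for y using ij(3) by simp
    ultimately have "neighbors (?C (Suc n)) z = neighbors (joined i u p (Suc n)) z"
      unfolding separated_def joined_def neighbors_final adj_member[OF 2(1)] by (simp only: simp_thms)
    moreover have "history_of A ?C n z = history_of A (joined i u p) n z"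
      by (rule history_separated[OF dist in_pool ij(3) UnI2[OF 2(1)] order_refl])
    ultimately have "msg A ?C n z u = msg A (joined i u p) n z u"
      by (simp add: msg_def) (simp add: separated_def joined_def net_0)
    also have "\<dots> = msg A ?H n z u"
      using 2 N_le by (intro traffic_eqD(2)[OF eq(1) ij(1)]) (auto simp: members_def)
    finally show ?thesis .
  qed
qed

section \<open>Cliques and degrees in the three kinds of networks\<close>

lemma joined_has_clique:
  assumes "u \<in> {1..N}" "v \<in> {1..N}" "u \<noteq> v" "i < I"
  shows "contains_copy (clique (r + 2)) (joined i u v (Suc n))"
proof (rule clique_copyI)
  let ?K = "insert u (insert v (members i))"
  have out: "u \<notin> members i" "v \<notin> members i" using assms by (auto simp: members_def)
  show "finite ?K" "card ?K = r + 2" using card_members assms(3) out by simp_all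
  have "members i \<subseteq> {1..n}" "{u, v} \<subseteq> {1..n}" using members_subset[OF assms(4)] assms N_le by auto
  then show "?K \<subseteq> verts (joined i u v (Suc n))" by (simp add: joined_def verts_net present_final)
  fix y z assume yz: "y \<in> ?K" "z \<in> ?K" "y \<noteq> z"
  let ?att = "\<lambda>z. if z \<in> {u, v} then Some i else None"
  have "y \<in> {1..n}" "z \<in> {1..n}"
    using yz(1,2) \<open>members i \<subseteq> {1..n}\<close> \<open>{u, v} \<subseteq> {1..n}\<close> by auto
  moreover have "adj ?att y z \<or> {y, z} \<in> {{u, v}}"
  proof (cases "z \<in> members i")
    case True
    then show ?thesis using yz assms unfolding adj_member[OF True] by auto
  next
    case False
    then have "z \<in> {u, v}" "z \<le> N" using yz(2) assms by auto
    then show ?thesis using yz by (auto simp: adj_pool)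
  qed
  ultimately show "{y, z} \<in> edges (joined i u v (Suc n))"
    unfolding joined_def edges_net present_final by simp
qed

text \<open>Block nodes are coloured by offset and pool nodes by \<open>r\<close>, except that
  \<open>x\<close> gets 0: its only neighbors are \<open>u\<close> and \<open>v\<close>. Thus
  \<open>r + 1\<close> colours suffice.\<close>

lemma witnessed_no_clique:
  assumes "u \<in> {1..N}" "v \<in> {1..N}" "x \<in> {1..N}" "x \<noteq> u" "x \<noteq> v"
  shows "\<not> contains_copy (clique (r + 2)) (witnessed i u v x t)"
proof (rule no_clique_if_coloured)
  define \<chi> where "\<chi> z = (if N < z then (z - Suc N) mod r else if z = x then 0 else r)" for z
  have lt: "k mod r < r" "k mod r \<noteq> r" "r \<noteq> k mod r" for k
    using r mod_less_divisor[of r k] by linarith+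
  show "\<chi> y \<noteq> \<chi> z" if "{y, z} \<in> edges (witnessed i u v x t)" for y z
    using that assms lt r offset_neq[of y z]
    by (auto simp: witnessed_def edges_net adj_def \<chi>_def doubleton_eq_iff split: if_splits)
  show "\<chi> z < r + 1" if "z \<in> verts (witnessed i u v x t)" for z
    using lt(1) by (simp add: \<chi>_def less_SucI)
qed simp

text \<open>The final edge forces different colours on \<open>u\<close> and \<open>v\<close>.
  Shifting the colours of block \<open>j\<close> to 1 up to \<open>r\<close> frees 0 for
  \<open>v\<close> and \<open>q\<close>, while \<open>u\<close> and \<open>p\<close> keep
  \<open>r\<close>.\<close>

lemma separated_no_clique:
  assumes "{u, p, v, q} \<subseteq> {1..N}" "distinct [u, p, v, q]" "i \<noteq> j"
  shows "\<not> contains_copy (clique (r + 2)) (separated i j u p v q t)"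
proof (rule no_clique_if_coloured)
  define \<chi> where "\<chi> z = (if N < z then (if block z = j then Suc ((z - Suc N) mod r) else (z - Suc N) mod r)
    else if z \<in> {v, q} then 0 else r)" for z
  have lt: "k mod r < r" "k mod r \<noteq> r" "r \<noteq> k mod r" for k
    using r mod_less_divisor[of r k] by linarith+
  have cross: "\<chi> w \<noteq> \<chi> z" if "N < w" "z \<le> N"
    "(if z \<in> {u, p} then Some i else if z \<in> {v, q} then Some j else None) = Some (block w)" for w z
  proof (cases "z \<in> {u, p}")
    case True
    then have "z \<notin> {v, q}" using assms(2) by auto
    moreover have "block w = i" using True that(3) by simp
    ultimately show ?thesis using that(1,2) assms(3) lt by (simp add: \<chi>_def)
  next
    case False
    then have "z \<in> {v, q}" "block w = j" using that(3) by (simp_all split: if_splits)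
    then show ?thesis using that(1,2) by (simp add: \<chi>_def)
  qed
  show "\<chi> y \<noteq> \<chi> z" if "{y, z} \<in> edges (separated i j u p v q t)" for y z
  proof -
    let ?att = "\<lambda>z. if z \<in> {u, p} then Some i else if z \<in> {v, q} then Some j else None"
    have "adj ?att y z \<or> {y, z} = {u, v}" using that by (auto simp only: separated_def edges_net singleton_iff)
    then consider "N < y" "N < z" "y \<noteq> z" "block y = block z" | "N < y" "z \<le> N" "?att z = Some (block y)"
      | "N < z" "y \<le> N" "?att y = Some (block z)" | "{y, z} = {u, v}"
      unfolding adj_def by blast
    then show ?thesis
    proof cases
      case 1
      then show ?thesis using offset_neq[of y z] by (simp add: \<chi>_def)
    next
      case 2
      then show ?thesis by (rule cross)
    next
      case 3
      then show ?thesis using cross[of z y] by metis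
    next
      case 4
      have "\<chi> u = r" "\<chi> v = 0" using assms(1,2) by (auto simp: \<chi>_def)
      then show ?thesis using 4 r by (auto simp: doubleton_eq_iff)
    qed
  qed
  show "\<chi> z < r + 1" if "z \<in> verts (separated i j u p v q t)" for z
    using lt(1) by (simp add: \<chi>_def less_SucI)
qed simp

lemma joined_bounded:
  assumes "u \<in> {1..N}" "v \<in> {1..N}" "u \<noteq> v"
  shows "joined i u v \<in> bounded_degree_networks (r + 4) n"
  unfolding joined_def
  by (rule net_bounded_degree[where K = "{u, v}", OF net_dynamic]) (use assms in \<open>auto simp: card_insert_if\<close>)

lemma witnessed_bounded:
  assumes "u \<in> {1..N}" "v \<in> {1..N}" "x \<in> {1..N}" "x \<noteq> u" "x \<noteq> v"
  shows "witnessed i u v x \<in> bounded_degree_networks (r + 4) n"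
  unfolding witnessed_def
  by (rule net_bounded_degree[where K = "{u, v, x}", OF net_dynamic]) (use assms in \<open>auto simp: card_insert_if\<close>)

lemma separated_bounded:
  assumes "{u, p, v, q} \<subseteq> {1..N}" "distinct [u, p, v, q]"
  shows "separated i j u p v q \<in> bounded_degree_networks (r + 4) n"
  unfolding separated_def
  by (rule net_bounded_degree[where K = "{u, p, v, q}", OF net_dynamic]) (use assms in \<open>auto simp: card_insert_if\<close>)

section \<open>The contradiction for a quadruple and two blocks\<close>

lemma detection_impossible:
  assumes pool: "{a, b, c, d} \<subseteq> {1..N}" "distinct [a, b, c, d]"
    and eq: "traffic a b = traffic a d" "traffic a c = traffic a d"
      "traffic d b = traffic d a" "traffic d c = traffic d a"
    and ij: "i < I" "j < I" "i \<noteq> j"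
    and final: "msg A (joined j a d) n d a = msg A (joined i a d) n d a"
      "msg A (joined j a d) n a d = msg A (joined i a d) n a d"
    and det: "\<And>G. G \<in> bounded_degree_networks (r + 4) n \<Longrightarrow> detects A (clique (r + 2)) G"
  shows False
proof -
  have no: "\<not> says_yes A (G 0) y (history_of A G (Suc n) y)"
    if "G \<in> bounded_degree_networks (r + 4) n" "\<not> contains_copy (clique (r + 2)) (G (Suc n))"
      "y \<in> verts (G (Suc n))" for G y
    using det[OF that(1)] that(2,3) unfolding detects_def by (metis le_add1 plus_1_eq_Suc)
  let ?H = "joined i a d"
  have abcd: "a \<in> {1..N}" "b \<in> {1..N}" "c \<in> {1..N}" "d \<in> {1..N}" "a \<noteq> d" using pool by auto
  have "contains_copy (clique (r + 2)) (?H (Suc n))"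
    using abcd ij(1) by (intro joined_has_clique)
  moreover have "detects A (clique (r + 2)) ?H"
    using abcd by (intro det joined_bounded)
  ultimately obtain y where y: "y \<in> verts (?H (Suc n))" "says_yes A (?H 0) y (history_of A ?H (Suc n) y)"
    unfolding detects_def by (metis le_add1 plus_1_eq_Suc)
  \<comment> \<open>Outputs also depend on the initial graph, which is empty in all these
    networks.\<close>
  have zero: "?H 0 = ({}, {})" by (simp add: joined_def net_0)
  have yn: "y \<in> {1..n}" using y(1) by (simp add: joined_def verts_net present_def)
  consider "y = a" | "y = d" | "y \<notin> {a, d}" by blast
  then show False
  proof cases
    case 1
    \<comment> \<open>Here \<open>b\<close> stands in for \<open>d\<close> on block
      \<open>i\<close>, and \<open>c\<close> for \<open>a\<close> on block \<open>j\<close>. The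
      case of \<open>d\<close> exchanges the two halves and uses the other equation of
      \<open>final\<close>.\<close>
    let ?C = "separated i j a b d c"
    have dist: "distinct [a, b, d, c]" "{a, b, d, c} \<subseteq> {1..N}" using pool by auto
    have "\<not> says_yes A (?C 0) a (history_of A ?C (Suc n) a)"
      using abcd(1) N_le
      by (intro no separated_bounded separated_no_clique dist ij)
         (auto simp: separated_def verts_net present_def)
    moreover have "history_of A ?C (Suc n) a = history_of A ?H (Suc n) a"
      by (rule separated_view) (use dist ij eq final in auto)
    ultimately show False using y(2) 1 zero by (simp add: separated_def net_0)
  next
    case 2
    let ?C = "separated i j d c a b"
    have dist: "distinct [d, c, a, b]" "{d, c, a, b} \<subseteq> {1..N}" using pool by auto
    have "\<not> says_yes A (?C 0) d (history_of A ?C (Suc n) d)"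
      using abcd(4) N_le
      by (intro no separated_bounded separated_no_clique dist ij)
         (auto simp: separated_def verts_net present_def)
    moreover have "history_of A ?C (Suc n) d = history_of A (joined i d a) (Suc n) d"
      by (rule separated_view)
         (use dist ij eq final in \<open>simp_all add: joined_commute[of _ d a]\<close>)
    then have "history_of A ?C (Suc n) d = history_of A ?H (Suc n) d"
      by (simp only: joined_commute[of i d a])
    ultimately show False using y(2) 2 zero by (simp add: separated_def net_0)
  next
    case 3
    \<comment> \<open>The inserted node must differ from the answering node \<open>y\<close>, which
      may itself be \<open>b\<close> or \<open>c\<close>; hence two candidates.\<close>
    define x where "x = (if y = b then c else b)"
    have x: "x \<in> {1..N}" "x \<noteq> a" "x \<noteq> d" "y \<notin> {a, d, x}"
      "traffic a x = traffic a d" "traffic d x = traffic d a"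
      using pool eq 3 by (auto simp: x_def)
    let ?K = "witnessed i a d x"
    have "\<not> says_yes A (?K 0) y (history_of A ?K (Suc n) y)"
      using abcd x yn
      by (intro no witnessed_bounded witnessed_no_clique) (auto simp: witnessed_def verts_net present_def)
    moreover have "history_of A ?K (Suc n) y = history_of A ?H (Suc n) y"
      using abcd x ij(1) by (intro witnessed_view)
    ultimately show False using y(2) zero by (simp add: witnessed_def net_0)
  qed
qed

text \<open>The pool size \<open>N\<close> does not enter, so the number of colours stays fixed
  while the pool grows.\<close>

lemma card_traffic_index: "card traffic_index = I * (I * r + 1) * (I * r) * 2"
proof -
  have "card {N..n} = I * r + 1" "card {N<..n} = I * r" by (simp_all add: n)
  then show ?thesis
    unfolding traffic_index_def card_cartesian_product by (simp only: card_lessThan card_UNIV_bool mult.assoc)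
qed

lemma pool_bound:
  fixes B :: nat
  defines "q \<equiv> (2 ^ B + 1) ^ (I * (I * r + 1) * (I * r) * 2)"
  assumes B: "has_bandwidth A B" and I: "I = (2 ^ B + 1) ^ 2 + 1"
    and det: "\<And>G. G \<in> bounded_degree_networks (r + 4) n \<Longrightarrow> detects A (clique (r + 2)) G"
  shows "N < (q ^ 2) ^ (3 * q ^ 2 + 1)"
proof (rule ccontr)
  let ?Q = "traffic_index \<rightarrow>\<^sub>E messages B"
  have fin: "finite traffic_index" by (simp add: traffic_index_def)
  have finQ: "finite ?Q" using fin card_messages(1) by (intro finite_PiE)
  have cQ: "card ?Q = q"
    using fin by (simp only: card_funcsetE card_messages card_traffic_index q_def)
  have "1 \<le> I * (I * r + 1) * (I * r) * 2" using I r by simp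
  then have "(2 ^ B + 1) ^ 1 \<le> q" unfolding q_def by (intro power_increasing) simp_all
  moreover have "(1::nat) \<le> 2 ^ B" by simp
  ultimately have q2: "2 \<le> card ?Q" unfolding cQ power_one_right by linarith
  have traffic: "traffic u v \<in> ?Q" for u v
    using msg_in_messages[OF B] by (auto simp: traffic_def PiE_iff)
  assume "\<not> ?thesis"
  then have large: "(card ?Q ^ 2) ^ (3 * card ?Q ^ 2 + 1) \<le> card {1..N}" by (simp only: cQ not_less card_atLeastAtMost diff_Suc_1)
  obtain a b c d where pool: "{a, b, c, d} \<subseteq> {1..N}" "distinct [a, b, c, d]"
    and eq: "traffic a b = traffic a d" "traffic a c = traffic a d"
      "traffic d b = traffic d a" "traffic d c = traffic d a"
    by (rule homogeneous_quadruple[OF finQ q2 traffic finite_atLeastAtMost large])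
  \<comment> \<open>The blocks can be chosen after the quadruple because a colour records the
    traffic of all \<open>I\<close> blocks at once. As \<open>I\<close> exceeds the number of pairs
    of messages, \<open>g\<close> takes some value twice.\<close>
  define g where "g i = (msg A (joined i a d) n d a, msg A (joined i a d) n a d)" for i
  have "card (g ` {..<I}) \<le> card (messages B \<times> messages B)"
    using card_messages(1) msg_in_messages[OF B] by (intro card_mono) (auto simp: g_def)
  also have "\<dots> < card {..<I}"
    by (simp only: card_cartesian_product card_messages I card_lessThan power2_eq_square)
  finally have "\<not> inj_on g {..<I}" by (rule pigeonhole)
  then obtain i j where ij: "i < I" "j < I" "i \<noteq> j" "g j = g i" by (auto simp: inj_on_def)
  then have "msg A (joined j a d) n d a = msg A (joined i a d) n d a"
    "msg A (joined j a d) n a d = msg A (joined i a d) n a d" by (simp_all add: g_def)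
  then show False by (rule detection_impossible[OF pool eq ij(1-3) _ _ det])
qed

end

subsection \<open>The bound\<close>

lemma bigomega_triple_log:
  fixes b :: "nat \<Rightarrow> nat"
  assumes C: "1 \<le> C" and bound: "\<And>n. n \<le> 2 ^ 2 ^ 2 ^ (C * (b n + 1))"
  shows "(\<lambda>n. real (b n)) \<in> \<Omega>(\<lambda>n. ln (ln (ln (real n))))"
\<comment> \<open>Three logarithms give at most \<open>C * b n + C\<close>; once the triple
  logarithm reaches \<open>2 * C\<close>, half of it absorbs the summand \<open>C\<close>.\<close>
proof (rule landau_omega.bigI[where c = "1 / (2 * real C)"])
  have "filterlim (\<lambda>n. ln (ln (ln (real n)))) at_top sequentially"
    by (intro filterlim_compose[OF ln_at_top] filterlim_real_sequentially)
  then have "eventually (\<lambda>n. 2 * real C \<le> ln (ln (ln (real n)))) sequentially"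
    by (simp add: filterlim_at_top)
  moreover have "filterlim (\<lambda>n. ln (ln (real n))) at_top sequentially"
    by (intro filterlim_compose[OF ln_at_top] filterlim_real_sequentially)
  then have "eventually (\<lambda>n. 1 \<le> ln (ln (real n))) sequentially"
    by (simp add: filterlim_at_top)
  moreover have "filterlim (\<lambda>n. ln (real n)) at_top sequentially"
    by (intro filterlim_compose[OF ln_at_top] filterlim_real_sequentially)
  then have "eventually (\<lambda>n. 1 \<le> ln (real n)) sequentially"
    by (simp add: filterlim_at_top)
  ultimately show "eventually (\<lambda>n. norm (real (b n)) \<ge> 1 / (2 * real C) * norm (ln (ln (ln (real n))))) sequentially"
    using eventually_gt_at_top[of 0]
  proof eventually_elim
    case (elim n)
    \<comment> \<open>Since \<open>ln 2\<close> is below 1, each natural logarithm strips one level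
      of the tower without an extra constant.\<close>
    have ln_pow: "ln y \<le> real m" if "0 < y" "y \<le> 2 ^ m" for y :: real and m :: nat
    proof -
      have "ln y \<le> ln (2 ^ m)" using that by simp
      also have "\<dots> = real m * ln 2" by (simp add: ln_realpow)
      also have "\<dots> \<le> real m * 1" using ln_2_less_1 by (intro mult_left_mono) auto
      finally show ?thesis by simp
    qed
    let ?e = "C * (b n + 1)"
    have "real n \<le> real (2 ^ 2 ^ 2 ^ ?e)" using bound[of n] by (simp only: of_nat_le_iff)
    then have "ln (real n) \<le> real (2 ^ 2 ^ ?e)"
      using elim by (intro ln_pow) simp_all
    then have "ln (ln (real n)) \<le> real (2 ^ ?e)"
      using elim by (intro ln_pow) (linarith, simp)
    then have "ln (ln (ln (real n))) \<le> real ?e"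
      using elim by (intro ln_pow) (linarith, simp)
    also have "\<dots> = real C * real (b n) + real C" by (simp add: algebra_simps)
    finally have *: "ln (ln (ln (real n))) / 2 \<le> real C * real (b n)" using elim by linarith
    have "1 / (2 * real C) * ln (ln (ln (real n))) \<le> real (b n)"
      using * C by (simp add: field_simps)
    then show ?case using elim C by simp
  qed
qed (use C in simp)

text \<open>With \<open>e = B + 1\<close>, the exponent \<open>d\<close> is at most exponential in
  \<open>e\<close>, and so is \<open>m = e * d\<close>, where \<open>q \<le> 2 ^ m\<close>. The
  Ramsey bound adds two exponentials on top of \<open>m\<close>. As \<open>e\<close> is at least 1,
  constants and \<open>r\<close> go into the factor \<open>20 + 4 * r\<close>.\<close>

lemma tower_bound:
  fixes B r :: nat
  defines "k \<equiv> 2 ^ B + 1"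
  defines "I \<equiv> k ^ 2 + 1"
  defines "q \<equiv> k ^ (I * (I * r + 1) * (I * r) * 2)"
  assumes n: "n \<le> (q ^ 2) ^ (3 * q ^ 2 + 1) + I * r" and r: "1 \<le> r"
  shows "n \<le> 2 ^ 2 ^ 2 ^ ((20 + 4 * r) * (B + 1))"
proof -
  define e where "e = B + 1"
  have e: "1 \<le> e" by (simp add: e_def)
  have k: "k \<le> 2 ^ e" "2 \<le> k" by (simp_all add: k_def e_def)
  have I: "I \<le> 2 ^ (3 * e)" "1 \<le> I"
  proof -
    have "k ^ 2 \<le> (2 ^ e) ^ 2" using k(1) by (rule power_mono) simp
    then have "I \<le> 2 ^ (2 * e) + 1" by (simp add: I_def power_mult mult.commute)
    also have "\<dots> \<le> 2 ^ Suc (2 * e)" by simp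
    also have "\<dots> \<le> 2 ^ (3 * e)" using e by (intro power_increasing) auto
    finally show "I \<le> 2 ^ (3 * e)" .
  qed (simp add: I_def)
  have Ir: "I * r \<le> 2 ^ (3 * e + r)"
    using mult_le_mono[OF I(1) less_imp_le[OF less_exp[of r]]] by (simp add: power_add)
  have Ir1: "I * r + 1 \<le> 2 ^ (3 * e + r + 1)" 
  proof -
    have "(1::nat) \<le> 2 ^ (3 * e + r)" by simp
    moreover have "(2::nat) ^ (3 * e + r + 1) = 2 * 2 ^ (3 * e + r)" by simp
    ultimately show ?thesis using Ir by linarith
  qed
  define d where "d = I * (I * r + 1) * (I * r) * 2"
  have d: "d \<le> 2 ^ (9 * e + 2 * r + 2)"
  proof -
    have "d \<le> 2 ^ (3 * e) * 2 ^ (3 * e + r + 1) * 2 ^ (3 * e + r) * 2"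
      unfolding d_def using I(1) Ir Ir1 by (intro mult_le_mono) auto
    also have "\<dots> = 2 ^ (9 * e + 2 * r + 2)" by (simp flip: power_add power_Suc2 add: algebra_simps)
    finally show ?thesis .
  qed
  have d1: "1 \<le> d" using I(2) r by (simp add: d_def)
  define m where "m = e * d"
  have m1: "1 \<le> m" using e d1 by (simp add: m_def)
  have q: "q \<le> 2 ^ m"
    unfolding q_def m_def d_def[symmetric] power_mult using k(1) by (rule power_mono) simp
  have m: "m \<le> 2 ^ (10 * e + 2 * r + 2)"
    using mult_le_mono[OF less_imp_le[OF less_exp[of e]] d]
    by (simp add: m_def power_add[symmetric] algebra_simps del: power_add)
  have q2: "q ^ 2 \<le> 2 ^ (2 * m)"
    using power_mono[OF q, of 2] by (simp add: power_mult mult.commute)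
  have "3 * q ^ 2 + 1 \<le> 4 * 2 ^ (2 * m)" using q2 one_le_power[of "2::nat" "2 * m"] by linarith
  then have ex: "3 * q ^ 2 + 1 \<le> 2 ^ (2 * m + 2)" by (simp add: power_add)
  have "(q ^ 2) ^ (3 * q ^ 2 + 1) \<le> (2 ^ (2 * m)) ^ (3 * q ^ 2 + 1)"
    using q2 by (rule power_mono) simp
  also have "\<dots> \<le> (2 ^ (2 * m)) ^ 2 ^ (2 * m + 2)" using ex by (intro power_increasing) auto
  also have "\<dots> = 2 ^ (2 * m * 2 ^ (2 * m + 2))" by (rule power_mult[symmetric])
  also have "\<dots> \<le> 2 ^ 2 ^ (4 * m + 2)"
  proof (rule power_increasing)
    have "2 * m * 2 ^ (2 * m + 2) \<le> 2 ^ (2 * m) * 2 ^ (2 * m + 2)"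
      using less_imp_le[OF less_exp[of "2 * m"]] by (rule mult_le_mono1)
    also have "\<dots> = 2 ^ (4 * m + 2)" by (simp flip: power_add)
    finally show "2 * m * 2 ^ (2 * m + 2) \<le> 2 ^ (4 * m + 2)" .
  qed simp
  finally have 1: "(q ^ 2) ^ (3 * q ^ 2 + 1) \<le> 2 ^ 2 ^ (4 * m + 2)" .
  have "I * r \<le> d" using I(2) by (simp add: d_def)
  also have "\<dots> \<le> m" using e by (simp add: m_def)
  also have "\<dots> \<le> 2 ^ m" by (rule less_imp_le[OF less_exp])
  also have "\<dots> \<le> 2 ^ 2 ^ (4 * m + 2)"
    using less_exp[of "4 * m + 2"] by (intro power_increasing) linarith+
  finally have "n \<le> 2 * 2 ^ 2 ^ (4 * m + 2)" using n 1 by linarith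
  also have "\<dots> \<le> 2 ^ 2 ^ (4 * m + 3)"
  proof -
    have "Suc (2 ^ (4 * m + 2)) \<le> 2 ^ (4 * m + 3)" by (simp add: power_add)
    then have "(2::nat) ^ Suc (2 ^ (4 * m + 2)) \<le> 2 ^ 2 ^ (4 * m + 3)" by (intro power_increasing) auto
    then show ?thesis by simp
  qed
  also have "\<dots> \<le> 2 ^ 2 ^ 2 ^ ((20 + 4 * r) * e)"
  proof (intro power_increasing)
    have "4 * m + 3 \<le> 8 * m" using m1 by linarith
    also have "\<dots> \<le> 8 * 2 ^ (10 * e + 2 * r + 2)" using m by simp
    also have "\<dots> = 2 ^ (10 * e + 2 * r + 5)" by (simp add: power_add)
    also have "\<dots> \<le> 2 ^ ((20 + 4 * r) * e)"
    proof (rule power_increasing)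
      have "r * 1 \<le> r * e" using e by (rule mult_le_mono2)
      moreover have "(20 + 4 * r) * e = 20 * e + 4 * (r * e)" by (simp add: algebra_simps)
      ultimately show "10 * e + 2 * r + 5 \<le> (20 + 4 * r) * e" using e by linarith
    qed simp
    finally show "4 * m + 3 \<le> 2 ^ ((20 + 4 * r) * e)" .
  qed simp_all
  finally show ?thesis by (simp add: e_def)
qed

lemma bandwidth_bound:
  assumes B: "has_bandwidth A B" and s: "3 \<le> s"
    and det: "\<And>G. G \<in> bounded_degree_networks (s + 2) n \<Longrightarrow> detects A (clique s) G"
  shows "n \<le> 2 ^ 2 ^ 2 ^ ((20 + 4 * (s - 2)) * (B + 1))"
proof -
  let ?r = "s - 2" and ?k = "2 ^ B + 1 :: nat"
  let ?I = "?k ^ 2 + 1"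
  let ?q = "?k ^ (?I * (?I * ?r + 1) * (?I * ?r) * 2)"
  have sr: "1 \<le> ?r" "s = ?r + 2" "s + 2 = ?r + 4" using s by simp_all
  have "n \<le> (?q ^ 2) ^ (3 * ?q ^ 2 + 1) + ?I * ?r"
  \<comment> \<open>All nodes outside the blocks form the pool. With too few nodes for the blocks
    the bound is immediate.\<close>
  proof (cases "?I * ?r \<le> n")
    case True
    define N where "N = n - ?I * ?r"
    interpret one_round N ?r ?I n A
      using sr(1) True by unfold_locales (simp_all only: N_def le_add_diff_inverse2)
    have "N < (?q ^ 2) ^ (3 * ?q ^ 2 + 1)"
      by (rule pool_bound[OF B refl]) (use det sr(2,3) in simp)
    then show ?thesis using True unfolding N_def by linarith
  qed linarith
  then show ?thesis by (rule tower_bound[OF _ sr(1)])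
qed

text \<open>The inclusions cover both halves of the theorem: the lower one supplies the hard
  networks, the upper one an algorithm, so that the minimum is attained.\<close>

lemma complexity_lower_bound:
  assumes s: "3 \<le> s" and "\<And>n. bounded_degree_networks (s + 2) n \<subseteq> \<N> n"
    and "\<And>n. \<N> n \<subseteq> dynamic_networks n"
  shows "(\<lambda>n. real (one_round_bandwidth_complexity \<N> (clique s) n)) \<in> \<Omega>(\<lambda>n. ln (ln (ln (real n))))"
proof (rule bigomega_triple_log)
  show "1 \<le> 20 + 4 * (s - 2)" by simp
  fix n
  have "\<exists>B A. has_bandwidth A B \<and> (\<forall>G\<in>\<N> n. detects A (clique s) G)"
    using s assms(3) by (intro clique_algorithm_exists) simp_all
  then have "\<exists>A. has_bandwidth A (one_round_bandwidth_complexity \<N> (clique s) n) \<and>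
      (\<forall>G\<in>\<N> n. detects A (clique s) G)"
    unfolding one_round_bandwidth_complexity_def by (rule LeastI_ex)
  then obtain A where A: "has_bandwidth A (one_round_bandwidth_complexity \<N> (clique s) n)"
    "\<forall>G\<in>\<N> n. detects A (clique s) G" by blast
  show "n \<le> 2 ^ 2 ^ 2 ^ ((20 + 4 * (s - 2)) * (one_round_bandwidth_complexity \<N> (clique s) n + 1))"
    by (rule bandwidth_bound[OF A(1) s]) (use A(2) assms(2) in blast)
qed

theorem theorem1p6:
  fixes s :: nat
  assumes "s \<ge> 3"
  shows "(\<lambda>n. real (one_round_bandwidth_complexity dynamic_networks (clique s) n))
           \<in> \<Omega>(\<lambda>n. ln (ln (ln (real n)))) \<and>
         (\<exists>\<Delta>. (\<lambda>n. real (one_round_bandwidth_complexity (bounded_degree_networks \<Delta>) (clique s) n))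
           \<in> \<Omega>(\<lambda>n. ln (ln (ln (real n)))))"
proof (intro conjI exI)
  show "(\<lambda>n. real (one_round_bandwidth_complexity dynamic_networks (clique s) n))
      \<in> \<Omega>(\<lambda>n. ln (ln (ln (real n))))"
    by (rule complexity_lower_bound[OF assms]) (auto simp: bounded_degree_networks_def)
  show "(\<lambda>n. real (one_round_bandwidth_complexity (bounded_degree_networks (s + 2)) (clique s) n))
      \<in> \<Omega>(\<lambda>n. ln (ln (ln (real n))))"
    by (rule complexity_lower_bound[OF assms]) (auto simp: bounded_degree_networks_def)
qed

end
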